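(* Suppose that the integral transform $T_\kappa\colon\Gamma(E)\to\Gamma'(F)$ is $G$-equivariant. Moreover, assume that for every $b\in B$ the measure $\bar\mu_b\colon\mathcal B(G.b)\to[0,\infty]$ is strictly positive, that $G.b$ is paracompact, and that any compactly supported continuous section of the restricted vector bundle $E|_{G.b}\to G.b$ has a continuous extension to a section of $E\to B$, where $E|_{G.b}:=\bigcup_{c\in G.b}E_c$. Then $$g.\kappa(c,b)(v)=\kappa(g.c,g.b)(g.v)$$ for all $g\in G$, $b\in B$, $c\in G.b$, and $v\in E_c$.
   Context: $G$ is a Hausdorff topological group and $B$ is a Hausdorff topological space with a continuous left action $(g,b)\mapsto g.b$; $G.b\subseteq B$ is the orbit of $b$ with the subspace topology. A $G$-equivariant real vector bundle $E\to B$ is a (finite-rank, locally trivial) real vector bundle with a continuous left $G$-action on $E$ such that the projection is $G$-equivariant and each $g\in G$ maps the fiber $E_b$ linearly to $E_{g.b}$. Let $E\to B$ and $F\to B$ be $G$-equivariant real vector bundles. $\Gamma(E)$ is the space of continuous sections of $E$, and $\Gamma'(F)$ is the space of all not necessarily continuous sections of $F$; $G$ acts on sections by $(g.f)(b):=g.f(g^{-1}.b)$. $\{\bar\mu_b\colon\mathcal B(G.b)\to[0,\infty]\}_{b\in B}$ is a family of locally finite Borel measures on the orbits with $\bar\mu_{g.b}=(g.\_)_*\bar\mu_b$ for all $g\in G$, $b\in B$ (pushforward along $c\mapsto g.c$). Strictly positive means that nonempty open sets have positive measure. Let $\bigsqcup_{b\in B}G.b:=\{(c,b)\in B\times B\mid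 c\in G.b\}$ with the subspace topology of $B\times B$. View $E\times B$ and $B\times F$ as vector bundles over $B\times B$, so that the bundle $\mathrm{Hom}(E\times B,B\times F)\to B\times B$ has fiber $\mathrm{Hom}(E_c,F_b)$ over $(c,b)$. The kernel $\kappa\colon\bigsqcup_{b\in B}G.b\to\mathrm{Hom}(E\times B,B\times F)$ is a continuous map with $\kappa(c,b)\in\mathrm{Hom}(E_c,F_b)$ such that for each $b\in B$ the partial map $\kappa(-,b)$ on $G.b$ is compactly supported. The orbitwise integral transform is $T_\kappa(f)(b):=\int_{G.b}\kappa(c,b)(f(c))\,d\bar\mu_b(c)$. *)

theory Defs
  imports "HOL-Analysis.Analysis"
begin

section \<open>Topological group actions\<close>

text \<open>
  Topological groups are rendered by the class \<^class>\<open>topological_group_add\<close>. Despite the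
  additive notation, commutativity is not assumed: \<open>g + h\<close> is the product, \<open>0\<close> the unit
  and \<open>- g\<close> the inverse.
\<close>

definition continuous_action ::
    "('g::topological_group_add \<Rightarrow> 'x::topological_space \<Rightarrow> 'x) \<Rightarrow> bool" where
  "continuous_action act \<longleftrightarrow>
     (\<forall>x. act 0 x = x) \<and>
     (\<forall>g h x. act (g + h) x = act g (act h x)) \<and>
     continuous_on UNIV (\<lambda>(g, x). act g x)"

definition orbit :: "('g \<Rightarrow> 'x \<Rightarrow> 'x) \<Rightarrow> 'x \<Rightarrow> 'x set" where
  "orbit act x = range (\<lambda>g. act g x)"

definition paracompact_space :: "'x topology \<Rightarrow> bool" where
  "paracompact_space X \<longleftrightarrow>
     Hausdorff_space X \<and>
     (\<forall>\<U>. (\<forall>U\<in>\<U>. openin X U) \<and> \<Union>\<U> = topspace X \<longrightarrow>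
        (\<exists>\<V>. (\<forall>V\<in>\<V>. openin X V) \<and> \<Union>\<V> = topspace X \<and>
             (\<forall>V\<in>\<V>. \<exists>U\<in>\<U>. V \<subseteq> U) \<and>
             (\<forall>x\<in>topspace X. \<exists>N. openin X N \<and> x \<in> N \<and> finite {V \<in> \<V>. V \<inter> N \<noteq> {}})))"

text \<open>\<open>P\<close> holds only inside a compact subset of the subspace \<open>S\<close>; the closure is taken in \<open>S\<close>.\<close>

definition compact_support_in :: "'x::topological_space set \<Rightarrow> ('x \<Rightarrow> bool) \<Rightarrow> bool" where
  "compact_support_in S P \<longleftrightarrow>
     compactin (top_of_set S) ((top_of_set S) closure_of {x \<in> S. P x})"


section \<open>Vector bundles\<close>

text \<open>
  The fibrewise operations are total functions on the total space; only their values on vectors of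
  a common fibre are meaningful. \<open>vzero E b\<close> is the zero vector of the fibre over \<open>b\<close>.
\<close>

record ('e, 'b) vbundle =
  proj :: "'e \<Rightarrow> 'b"
  vadd :: "'e \<Rightarrow> 'e \<Rightarrow> 'e"
  vscale :: "real \<Rightarrow> 'e \<Rightarrow> 'e"
  vzero :: "'b \<Rightarrow> 'e"

definition fibre :: "('e, 'b) vbundle \<Rightarrow> 'b \<Rightarrow> 'e set" where
  "fibre E b = {e. proj E e = b}"

locale real_vector_space_on =
  fixes V :: "'v set"
    and add :: "'v \<Rightarrow> 'v \<Rightarrow> 'v"
    and scale :: "real \<Rightarrow> 'v \<Rightarrow> 'v"
    and zero :: 'v
  assumes add_closed: "u \<in> V \<Longrightarrow> v \<in> V \<Longrightarrow> add u v \<in> V"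
    and scale_closed: "v \<in> V \<Longrightarrow> scale r v \<in> V"
    and zero_closed: "zero \<in> V"
    and add_assoc: "u \<in> V \<Longrightarrow> v \<in> V \<Longrightarrow> w \<in> V \<Longrightarrow> add (add u v) w = add u (add v w)"
    and add_commute: "u \<in> V \<Longrightarrow> v \<in> V \<Longrightarrow> add u v = add v u"
    and add_zero: "v \<in> V \<Longrightarrow> add zero v = v"
    and add_inverse: "v \<in> V \<Longrightarrow> \<exists>w\<in>V. add v w = zero"
    and scale_add_right: "u \<in> V \<Longrightarrow> v \<in> V \<Longrightarrow> scale r (add u v) = add (scale r u) (scale r v)"
    and scale_add_left: "v \<in> V \<Longrightarrow> scale (r + s) v = add (scale r v) (scale s v)"
    and scale_scale: "v \<in> V \<Longrightarrow> scale r (scale s v) = scale (r * s) v"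
    and scale_one: "v \<in> V \<Longrightarrow> scale 1 v = v"

text \<open>
  The model fibre is \<^term>\<open>Euclidean_space n\<close>, the sequences \<^typ>\<open>nat \<Rightarrow> real\<close> that vanish from
  index \<open>n\<close> on; in this way the rank may vary with the point of the base.
\<close>

definition local_trivialization ::
    "('e::topological_space, 'b::topological_space) vbundle \<Rightarrow> 'b set \<Rightarrow> nat \<Rightarrow>
     ('e \<Rightarrow> 'b \<times> (nat \<Rightarrow> real)) \<Rightarrow> bool" where
  "local_trivialization E U n \<phi> \<longleftrightarrow>
     open U \<and>
     homeomorphic_map (top_of_set (proj E -` U))
       (prod_topology (top_of_set U) (Euclidean_space n)) \<phi> \<and>
     (\<forall>e \<in> proj E -` U. fst (\<phi> e) = proj E e) \<and>
     (\<forall>b\<in>U. \<forall>u\<in>fibre E b. \<forall>v\<in>fibre E b.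
        snd (\<phi> (vadd E u v)) = (\<lambda>i. snd (\<phi> u) i + snd (\<phi> v) i)) \<and>
     (\<forall>b\<in>U. \<forall>v\<in>fibre E b. \<forall>r. snd (\<phi> (vscale E r v)) = (\<lambda>i. r * snd (\<phi> v) i))"

locale vector_bundle =
  fixes E :: "('e::topological_space, 'b::topological_space) vbundle"
  assumes continuous_proj: "continuous_on UNIV (proj E)"
    and fibre_vector_space: "real_vector_space_on (fibre E b) (vadd E) (vscale E) (vzero E b)"
    and locally_trivial: "\<exists>U n \<phi>. b \<in> U \<and> local_trivialization E U n \<phi>"

definition fibre_linear ::
    "('e, 'b) vbundle \<Rightarrow> ('f, 'c) vbundle \<Rightarrow> 'b \<Rightarrow> 'c \<Rightarrow> ('e \<Rightarrow> 'f) \<Rightarrow> bool" where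
  "fibre_linear E F c b A \<longleftrightarrow>
     (\<forall>u\<in>fibre E c. A u \<in> fibre F b) \<and>
     (\<forall>u\<in>fibre E c. \<forall>v\<in>fibre E c. A (vadd E u v) = vadd F (A u) (A v)) \<and>
     (\<forall>u\<in>fibre E c. \<forall>r. A (vscale E r u) = vscale F r (A u))"

locale equivariant_vector_bundle = vector_bundle E
  for E :: "('e::topological_space, 'b::topological_space) vbundle" +
  fixes act :: "'g::topological_group_add \<Rightarrow> 'b \<Rightarrow> 'b"
    and actE :: "'g \<Rightarrow> 'e \<Rightarrow> 'e"
  assumes action_total: "continuous_action actE"
    and proj_equivariant: "proj E (actE g e) = act g (proj E e)"
    and action_linear: "fibre_linear E E b (act g b) (actE g)"


section \<open>Sections\<close>

definition all_sections :: "('e, 'b) vbundle \<Rightarrow> ('b \<Rightarrow> 'e) set" where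
  "all_sections E = {f. \<forall>b. f b \<in> fibre E b}"

definition continuous_sections ::
    "('e::topological_space, 'b::topological_space) vbundle \<Rightarrow> ('b \<Rightarrow> 'e) set" where
  "continuous_sections E = {f \<in> all_sections E. continuous_on UNIV f}"

definition act_section ::
    "('g::group_add \<Rightarrow> 'b \<Rightarrow> 'b) \<Rightarrow> ('g \<Rightarrow> 'e \<Rightarrow> 'e) \<Rightarrow> 'g \<Rightarrow> ('b \<Rightarrow> 'e) \<Rightarrow> 'b \<Rightarrow> 'e" where
  "act_section act actE g f b = actE g (f (act (- g) b))"

text \<open>Sections of the restriction of \<open>E\<close> to \<open>S\<close>; values outside \<open>S\<close> are irrelevant.\<close>

definition compactly_supported_section_on ::
    "('e::topological_space, 'b::topological_space) vbundle \<Rightarrow> 'b set \<Rightarrow> ('b \<Rightarrow> 'e) \<Rightarrow> bool" where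
  "compactly_supported_section_on E S s \<longleftrightarrow>
     (\<forall>c\<in>S. s c \<in> fibre E c) \<and> continuous_on S s \<and>
     compact_support_in S (\<lambda>c. s c \<noteq> vzero E c)"


section \<open>The bundle Hom(E \<open>\<times>\<close> B, B \<open>\<times>\<close> F) over B \<open>\<times>\<close> B\<close>

definition fibre_hom :: "('e, 'b) vbundle \<Rightarrow> ('f, 'b) vbundle \<Rightarrow> 'b \<Rightarrow> 'b \<Rightarrow> ('e \<Rightarrow> 'f) set" where
  "fibre_hom E F c b = {A \<in> extensional (fibre E c). fibre_linear E F c b A}"

definition hom_total ::
    "('e, 'b) vbundle \<Rightarrow> ('f, 'b) vbundle \<Rightarrow> (('b \<times> 'b) \<times> ('e \<Rightarrow> 'f)) set" where
  "hom_total E F = {((c, b), A) | c b A. A \<in> fibre_hom E F c b}"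

text \<open>
  Over \<open>U \<times> V\<close>, trivializations \<open>\<phi>\<close> of \<open>E\<close> over \<open>U\<close> and \<open>\<psi>\<close> of \<open>F\<close> over \<open>V\<close> identify a linear
  map \<open>A\<close> from the fibre over \<open>c\<close> to the fibre over \<open>b\<close> with its \<open>m \<times> n\<close> matrix; the matrix is
  padded with zeros. The topology of the total space is the one generated by these charts.
\<close>

definition hom_chart ::
    "('e, 'b) vbundle \<Rightarrow> 'b set \<Rightarrow> nat \<Rightarrow> ('e \<Rightarrow> 'b \<times> (nat \<Rightarrow> real)) \<Rightarrow>
     nat \<Rightarrow> ('f \<Rightarrow> 'b \<times> (nat \<Rightarrow> real)) \<Rightarrow>
     ('b \<times> 'b) \<times> ('e \<Rightarrow> 'f) \<Rightarrow> ('b \<times> 'b) \<times> (nat \<Rightarrow> nat \<Rightarrow> real)" where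
  "hom_chart E U n \<phi> m \<psi> = (\<lambda>((c, b), A).
     ((c, b), \<lambda>i j. if i < m \<and> j < n
                then snd (\<psi> (A (inv_into (proj E -` U) \<phi> (c, \<lambda>k. if k = j then 1 else 0)))) i
                else 0))"

definition hom_topology ::
    "('e::topological_space, 'b::topological_space) vbundle \<Rightarrow>
     ('f::topological_space, 'b) vbundle \<Rightarrow> (('b \<times> 'b) \<times> ('e \<Rightarrow> 'f)) topology" where
  "hom_topology E F = topology_generated_by
     {{z \<in> hom_total E F. fst z \<in> U \<times> V \<and> hom_chart E U n \<phi> m \<psi> z \<in> W} | U n \<phi> V m \<psi> W.
        local_trivialization E U n \<phi> \<and> local_trivialization F V m \<psi> \<and> open W}"


section \<open>Measures on orbits and the orbitwise integral transform\<close>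

text \<open>
  The measurable sets of \<^term>\<open>restrict_space borel (orbit act b)\<close> are the Borel sets of the
  orbit with its subspace topology.
\<close>

locale orbit_measures =
  fixes act :: "'g \<Rightarrow> 'b::topological_space \<Rightarrow> 'b"
    and \<mu> :: "'b \<Rightarrow> 'b measure"
  assumes space_orbit: "space (\<mu> b) = orbit act b"
    and sets_orbit: "sets (\<mu> b) = sets (restrict_space borel (orbit act b))"
    and locally_finite:
      "c \<in> orbit act b \<Longrightarrow>
         \<exists>U. openin (top_of_set (orbit act b)) U \<and> c \<in> U \<and> emeasure (\<mu> b) U < \<infinity>"
    and pushforward:
      "\<mu> (act g b) = distr (\<mu> b) (restrict_space borel (orbit act (act g b))) (act g)"

definition strictly_positive_on :: "'b::topological_space set \<Rightarrow> 'b measure \<Rightarrow> bool" where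
  "strictly_positive_on S M \<longleftrightarrow>
     (\<forall>U. openin (top_of_set S) U \<and> U \<noteq> {} \<longrightarrow> emeasure M U > 0)"

definition orbit_pairs :: "('g \<Rightarrow> 'b \<Rightarrow> 'b) \<Rightarrow> ('b \<times> 'b) set" where
  "orbit_pairs act = {(c, b). c \<in> orbit act b}"

locale orbit_kernel =
  fixes E :: "('e::topological_space, 'b::topological_space) vbundle"
    and F :: "('f::topological_space, 'b) vbundle"
    and act :: "'g \<Rightarrow> 'b \<Rightarrow> 'b"
    and \<kappa> :: "'b \<times> 'b \<Rightarrow> 'e \<Rightarrow> 'f"
  assumes kernel_hom: "(c, b) \<in> orbit_pairs act \<Longrightarrow> \<kappa> (c, b) \<in> fibre_hom E F c b"
    and kernel_continuous:
      "continuous_map (top_of_set (orbit_pairs act)) (hom_topology E F) (\<lambda>z. (z, \<kappa> z))"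
    and kernel_compact_support:
      "compact_support_in (orbit act b) (\<lambda>c. \<exists>v\<in>fibre E c. \<kappa> (c, b) v \<noteq> vzero F b)"

definition fibre_functional :: "('f, 'b) vbundle \<Rightarrow> 'b \<Rightarrow> ('f \<Rightarrow> real) \<Rightarrow> bool" where
  "fibre_functional F b l \<longleftrightarrow>
     (\<forall>u\<in>fibre F b. \<forall>v\<in>fibre F b. l (vadd F u v) = l u + l v) \<and>
     (\<forall>u\<in>fibre F b. \<forall>r. l (vscale F r u) = r * l u)"

text \<open>
  The integral of a function with values in the finite-dimensional fibre over \<open>b\<close>: the vector
  that every linear functional maps to the integral of its composition with the function.
  The fibre is not a type, so the Bochner integral of the library is only available for
  these compositions. Uniqueness holds because functionals separate the points of the fibre.
\<close>

definition fibre_integral :: "('f, 'b) vbundle \<Rightarrow> 'b \<Rightarrow> 'c measure \<Rightarrow> ('c \<Rightarrow> 'f) \<Rightarrow> 'f" where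
  "fibre_integral F b M h =
     (THE w. w \<in> fibre F b \<and> (\<forall>l. fibre_functional F b l \<longrightarrow> l w = (\<integral>c. l (h c) \<partial>M)))"

definition orbit_transform ::
    "('f, 'b) vbundle \<Rightarrow> ('b \<Rightarrow> 'b measure) \<Rightarrow> ('b \<times> 'b \<Rightarrow> 'e \<Rightarrow> 'f) \<Rightarrow> ('b \<Rightarrow> 'e) \<Rightarrow> 'b \<Rightarrow> 'f" where
  "orbit_transform F \<mu> \<kappa> f b = fibre_integral F b (\<mu> b) (\<lambda>c. \<kappa> (c, b) (f c))"

definition equivariant_operator ::
    "('e::topological_space, 'b::topological_space) vbundle \<Rightarrow> ('g::group_add \<Rightarrow> 'b \<Rightarrow> 'b) \<Rightarrow>
     ('g \<Rightarrow> 'e \<Rightarrow> 'e) \<Rightarrow> ('g \<Rightarrow> 'f \<Rightarrow> 'f) \<Rightarrow> (('b \<Rightarrow> 'e) \<Rightarrow> 'b \<Rightarrow> 'f) \<Rightarrow> bool" where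
  "equivariant_operator E act actE actF T \<longleftrightarrow>
     (\<forall>g. \<forall>f\<in>continuous_sections E. T (act_section act actE g f) = act_section act actF g (T f))"

end

theory Submission
  imports Defs
begin

text \<open>
  Changing variables along \<open>c \<mapsto> g.c\<close>, equivariance of the transform says that the family
  \<open>D(c) = g \<circ> \<kappa>(c,b) - \<kappa>(g.c,g.b) \<circ> g\<close> satisfies \<open>\<integral> D(c)(f(c)) d\<mu>\<^sub>b(c) = 0\<close> for every continuous
  section \<open>f\<close>. If \<open>l(D(c\<^sub>0)(v\<^sub>0)) \<noteq> 0\<close> for some functional \<open>l\<close>, extend \<open>v\<^sub>0\<close> to a local section \<open>v\<close> and
  put \<open>d(c) = l(D(c)(v(c)))\<close>. The open set where \<open>d \<noteq> 0\<close> lies in the compact support of \<open>D\<close>, so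
  Urysohn's lemma in that compact set gives a compactly supported bump function \<open>\<eta>\<close> with
  \<open>\<eta>(c\<^sub>0) = 1\<close>, without any local compactness of the orbit. Testing with an extension of \<open>\<eta> d v\<close>
  gives \<open>\<integral> \<eta> d\<^sup>2 d\<mu>\<^sub>b = 0\<close>, which contradicts strict positivity.
\<close>


section \<open>Bump functions\<close>

lemma continuous_on_locally:
  assumes "\<And>x. x \<in> S \<Longrightarrow> \<exists>N. openin (top_of_set S) N \<and> x \<in> N \<and> continuous_on N f"
  shows "continuous_on S f"
  unfolding continuous_on_def
proof
  fix x assume x: "x \<in> S"
  then obtain N where N: "openin (top_of_set S) N" "x \<in> N" "continuous_on N f"
    using assms by blast
  then obtain T where T: "open T" "N = S \<inter> T"
    by (metis openin_open)
  have "(f \<longlongrightarrow> f x) (at x within N)"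
    using N by (simp add: continuous_on_def)
  moreover have "at x within N = at x within S"
    using T N by (intro at_within_nhd[of x T]) auto
  ultimately show "(f \<longlongrightarrow> f x) (at x within S)" by simp
qed

text \<open>The compact Hausdorff set \<open>K\<close> is normal, and \<open>W\<close> is open in
  \<open>K\<close> as well as in \<open>X\<close>, so Urysohn's lemma applies inside
  \<open>K\<close>. Extension by zero is continuous because \<open>X\<close> is the union of two
  relatively open pieces: \<open>W\<close> and the complement of the compact set
  \<open>C\<close>.\<close>

lemma compact_support_bump:
  fixes X :: "'a::t2_space set"
  assumes "compact K" "W \<subseteq> K" "K \<subseteq> X" "openin (top_of_set X) W" "x \<in> W"
  obtains \<eta> :: "'a \<Rightarrow> real" and C where "continuous_on X \<eta>" "\<eta> x = 1" "\<And>y. \<eta> y \<ge> 0"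
    "compact C" "C \<subseteq> W" "\<And>y. y \<notin> C \<Longrightarrow> \<eta> y = 0"
proof -
  have KW: "openin (top_of_set K) W"
    using assms(2-4) openin_subset_trans by blast
  have "Hausdorff_space (top_of_set K)"
    by (intro Hausdorff_space_subtopology) (simp add: Hausdorff_space_def disjnt_def, metis hausdorff)
  moreover have "compact_space (top_of_set K)"
    using assms(1) by (simp add: compact_space_subtopology)
  ultimately have "normal_space (top_of_set K)"
    by (simp add: compact_Hausdorff_or_regular_imp_normal_space)
  moreover have "closedin (top_of_set K) (K - W)"
    using KW by (simp add: closedin_def openin_subset double_diff assms(2))
  moreover have "closedin (top_of_set K) {x}"
    using assms by (intro closed_subset) auto
  moreover have "disjnt (K - W) {x}"
    using assms by auto
  ultimately obtain f where f: "continuous_map (top_of_set K) (top_of_set {0..1::real}) f"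
      "f ` (K - W) \<subseteq> {0}" "f ` {x} \<subseteq> {1}"
    using Urysohn_lemma[of "top_of_set K" "K - W" "{x}" 0 1] by auto
  have cf: "continuous_on K f"
    using f(1) by (simp add: continuous_map_in_subtopology)
  \<comment> \<open>The closure of the set where \<open>f\<close> is non-zero may leave
    \<open>W\<close>. Cutting at 1/2 gives a closed set that avoids the zeros of \<open>f\<close>,
    hence a compact \<open>C\<close> inside \<open>W\<close>; the rescaling
    \<open>2 * f y - 1\<close> sends 1/2 to 0 and keeps the value 1 at \<open>x\<close>.\<close>
  define C where "C = {y \<in> K. f y \<ge> 1/2}"
  define \<eta> where "\<eta> y = (if y \<in> C then 2 * f y - 1 else 0)" for y
  have "C = K \<inter> f -` {1/2..}"
    by (auto simp: C_def)
  then have closedC: "closedin (top_of_set K) C"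
    using continuous_closedin_preimage[OF cf, of "{1/2..}"] by simp
  then have "compact C"
    using assms(1) closedin_compact by blast
  moreover have CW: "C \<subseteq> W"
    using f(2) by (force simp: C_def)
  moreover have "\<eta> x = 1"
    using f(3) assms by (auto simp: \<eta>_def C_def)
  moreover have "\<eta> y \<ge> 0" for y
    by (auto simp: \<eta>_def C_def)
  moreover have "continuous_on X \<eta>"
  proof (rule continuous_on_locally)
    fix y assume y: "y \<in> X"
    show "\<exists>N. openin (top_of_set X) N \<and> y \<in> N \<and> continuous_on N \<eta>"
    proof (cases "y \<in> C")
      case True
      have eq: "\<eta> z = max 0 (2 * f z - 1)" if "z \<in> W" for z
        using that assms by (auto simp: \<eta>_def C_def max_def)
      have "continuous_on W f" using cf assms continuous_on_subset by blast
      then have "continuous_on W (\<lambda>z. max 0 (2 * f z - 1))"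
        by (intro continuous_intros)
      then have "continuous_on W \<eta>"
        using eq by (simp cong: continuous_on_cong)
      then show ?thesis using True CW assms by blast
    next
      case False
      have "closed C" using \<open>compact C\<close> compact_imp_closed by blast
      then have "openin (top_of_set X) (X - C)"
        by (metis Diff_eq openin_open open_Compl)
      moreover have "continuous_on (X - C) \<eta>"
        by (rule continuous_on_eq[OF continuous_on_const[of _ 0]]) (auto simp: \<eta>_def)
      ultimately show ?thesis using False y by blast
    qed
  qed
  moreover have "\<eta> y = 0" if "y \<notin> C" for y using that by (simp add: \<eta>_def)
  ultimately show ?thesis using that by blast
qed


section \<open>Trivializations and fibrewise functionals\<close>

text \<open>The vector over \<open>c\<close> with chart coordinates \<open>x\<close>, meaningful for
  \<open>c\<close> in \<open>U\<close> and \<open>x\<close> vanishing from the rank on. At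
  \<open>std_basis j\<close> it is the local frame, spelled as in \<open>hom_chart\<close> so that
  matrix entries of the kernel unfold to it.\<close>

abbreviation triv_inv where
  "triv_inv E U \<phi> c x \<equiv> inv_into (proj E -` U) \<phi> (c, x)"

abbreviation std_basis :: "nat \<Rightarrow> nat \<Rightarrow> real" where
  "std_basis j \<equiv> \<lambda>k. if k = j then 1 else 0"

context
  fixes E :: "('e::topological_space, 'b::topological_space) vbundle" and U n \<phi>
  assumes triv: "local_trivialization E U n \<phi>"
begin

lemma trivialization_bij:
  "bij_betw \<phi> (proj E -` U) (U \<times> {x. \<forall>i\<ge>n. x i = 0})"
proof -
  have "homeomorphic_map (top_of_set (proj E -` U)) (prod_topology (top_of_set U) (Euclidean_space n)) \<phi>"
    using triv by (simp add: local_trivialization_def)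
  then have "bij_betw \<phi> (topspace (top_of_set (proj E -` U)))
      (topspace (prod_topology (top_of_set U) (Euclidean_space n)))"
    by (simp add: homeomorphic_eq_everything_map bij_betw_def)
  then show ?thesis
    by (simp add: topspace_Euclidean_space)
qed

lemma trivialization_fst: "proj E e \<in> U \<Longrightarrow> fst (\<phi> e) = proj E e"
  using triv by (simp add: local_trivialization_def)

lemma trivialization_snd: "proj E e \<in> U \<Longrightarrow> i \<ge> n \<Longrightarrow> snd (\<phi> e) i = 0"
  using bij_betwE[OF trivialization_bij] by force

lemma trivialization_add:
  "c \<in> U \<Longrightarrow> u \<in> fibre E c \<Longrightarrow> v \<in> fibre E c \<Longrightarrow>
    snd (\<phi> (vadd E u v)) = (\<lambda>i. snd (\<phi> u) i + snd (\<phi> v) i)"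
  using triv by (simp add: local_trivialization_def)

lemma trivialization_scale:
  "c \<in> U \<Longrightarrow> v \<in> fibre E c \<Longrightarrow> snd (\<phi> (vscale E r v)) = (\<lambda>i. r * snd (\<phi> v) i)"
  using triv by (simp add: local_trivialization_def)

lemma trivialization_inject:
  assumes "c \<in> U" "u \<in> fibre E c" "v \<in> fibre E c" "snd (\<phi> u) = snd (\<phi> v)"
  shows "u = v"
proof -
  have "fst (\<phi> u) = fst (\<phi> v)"
    using assms trivialization_fst by (simp add: fibre_def)
  then show ?thesis
    using assms trivialization_bij
    by (auto simp: fibre_def bij_betw_def intro: prod_eqI dest: inj_onD)
qed

lemma trivialization_triv_inv:
  assumes "c \<in> U" "\<forall>i\<ge>n. x i = 0"
  shows "\<phi> (triv_inv E U \<phi> c x) = (c, x)" "triv_inv E U \<phi> c x \<in> fibre E c"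
proof -
  have in_range: "(c, x) \<in> \<phi> ` (proj E -` U)"
    using trivialization_bij assms by (auto simp: bij_betw_def)
  show 1: "\<phi> (triv_inv E U \<phi> c x) = (c, x)"
    using in_range by (rule f_inv_into_f)
  have "triv_inv E U \<phi> c x \<in> proj E -` U"
    using in_range by (rule inv_into_into)
  then show "triv_inv E U \<phi> c x \<in> fibre E c"
    using trivialization_fst[of "triv_inv E U \<phi> c x"] 1 by (simp add: fibre_def)
qed

lemma triv_inv_trivialization:
  assumes "c \<in> U" "v \<in> fibre E c"
  shows "triv_inv E U \<phi> c (snd (\<phi> v)) = v"
  by (rule trivialization_inject)
     (use assms trivialization_triv_inv[of c "snd (\<phi> v)"] trivialization_snd[of v] in \<open>auto simp: fibre_def\<close>)

lemma continuous_on_trivialization_coord: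
  "continuous_on (proj E -` U) (\<lambda>e. snd (\<phi> e) i)"
proof -
  have "continuous_map (top_of_set (proj E -` U)) (prod_topology (top_of_set U) (Euclidean_space n)) \<phi>"
    using triv by (simp add: local_trivialization_def homeomorphic_eq_everything_map)
  then have "continuous_map (top_of_set (proj E -` U)) (powertop_real UNIV) (snd \<circ> \<phi>)"
    unfolding Euclidean_space_def
    using continuous_map_in_subtopology continuous_map_snd_of by blast
  then show ?thesis
    by (simp add: continuous_map_componentwise_UNIV o_def)
qed

lemma continuous_on_triv_inv:
  assumes "continuous_on S f" "f ` S \<subseteq> U" "\<And>i. continuous_on S (\<lambda>c. x c i)"
    "\<And>c i. c \<in> S \<Longrightarrow> i \<ge> n \<Longrightarrow> x c i = 0"
  shows "continuous_on S (\<lambda>c. triv_inv E U \<phi> (f c) (x c))"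
proof -
  let ?Y = "prod_topology (top_of_set U) (Euclidean_space n)"
  obtain g where g: "homeomorphic_maps (top_of_set (proj E -` U)) ?Y \<phi> g"
    using triv by (auto simp: local_trivialization_def homeomorphic_map_maps)
  \<comment> \<open>\<open>inv_into\<close> picks preimages by choice, but \<open>\<phi>\<close> is
    injective, so it agrees with the continuous inverse \<open>g\<close> on the whole
    target.\<close>
  have "continuous_map ?Y (top_of_set (proj E -` U)) (inv_into (proj E -` U) \<phi>)"
  proof (rule continuous_map_eq)
    show "continuous_map ?Y (top_of_set (proj E -` U)) g"
      using g by (simp add: homeomorphic_maps_def)
    fix y assume "y \<in> topspace ?Y"
    then show "g y = inv_into (proj E -` U) \<phi> y"
      using g trivialization_bij
      by (auto simp: homeomorphic_maps_def bij_betw_def continuous_map_def Pi_iff intro!: inv_into_f_eq[symmetric])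
  qed
  moreover have "continuous_map (top_of_set S) ?Y (\<lambda>c. (f c, x c))"
    using assms
    by (auto simp: continuous_map_pairwise o_def Euclidean_space_def continuous_map_in_subtopology
        continuous_map_componentwise_UNIV)
  ultimately have "continuous_map (top_of_set S) (top_of_set (proj E -` U))
      (inv_into (proj E -` U) \<phi> \<circ> (\<lambda>c. (f c, x c)))"
    using continuous_map_compose by blast
  then show ?thesis
    by (simp add: continuous_map_in_subtopology o_def)
qed

end

section \<open>Linear functionals on fibres and the fibre integral\<close>

lemma functional_expansion:
  assumes triv: "local_trivialization E U n \<phi>" and "vector_bundle E" and L: "fibre_functional E c L"
    and c: "c \<in> U" and v: "v \<in> fibre E c"
  shows "L v = (\<Sum>j<n. snd (\<phi> v) j * L (triv_inv E U \<phi> c (std_basis j)))"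
proof -
  interpret vector_bundle E by fact
  interpret real_vector_space_on "fibre E c" "vadd E" "vscale E" "vzero E c"
    by (rule fibre_vector_space)
  note ti = trivialization_triv_inv[OF triv c]
  \<comment> \<open>Here \<open>k\<close> bounds the coordinates that may be non-zero. Each
    induction step splits off one frame vector, so no finite sum of vectors in a fibre has to be
    formed; \<open>k = n\<close> covers every vector.\<close>
  have "L u = (\<Sum>j<k. snd (\<phi> u) j * L (triv_inv E U \<phi> c (std_basis j)))"
    if "k \<le> n" "u \<in> fibre E c" "\<forall>i\<ge>k. snd (\<phi> u) i = 0" for k u
    using that
  proof (induction k arbitrary: u)
    case 0
    \<comment> \<open>All coordinates of \<open>u\<close> vanish, so \<open>u\<close> equals its
      multiple by 0 and \<open>L\<close> kills it.\<close>
    have "vscale E 0 u = u"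
      by (rule trivialization_inject[OF triv c])
         (use 0 in \<open>auto simp: scale_closed trivialization_scale[OF triv c] fun_eq_iff\<close>)
    then have "L u = 0 * L u"
      using L 0 unfolding fibre_functional_def by metis
    then show ?case by simp
  next
    case (Suc k)
    let ?e = "triv_inv E U \<phi> c (std_basis k)"
    \<comment> \<open>Erasing coordinate \<open>k\<close> of \<open>u\<close> gives
      \<open>?w\<close>, to which the induction hypothesis applies.\<close>
    let ?x = "(snd (\<phi> u))(k := 0)"
    let ?w = "triv_inv E U \<phi> c ?x"
    have e: "?e \<in> fibre E c" "\<phi> ?e = (c, std_basis k)"
      using Suc.prems by (auto intro!: ti)
    have w: "?w \<in> fibre E c" "\<phi> ?w = (c, ?x)"
      using Suc.prems by (auto intro!: ti)
    have "u = vadd E ?w (vscale E (snd (\<phi> u) k) ?e)"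
      by (rule trivialization_inject[OF triv c])
         (use Suc.prems e w in \<open>auto simp: scale_closed add_closed trivialization_scale[OF triv c]
           trivialization_add[OF triv c]\<close>)
    then have "L u = L (vadd E ?w (vscale E (snd (\<phi> u) k) ?e))" by simp
    also have "\<dots> = L ?w + snd (\<phi> u) k * L ?e"
      using L e w scale_closed unfolding fibre_functional_def by metis
    also have "L ?w = (\<Sum>j<k. ?x j * L (triv_inv E U \<phi> c (std_basis j)))"
      using Suc.prems(1,3) w by (subst Suc.IH) (auto simp: Suc_le_eq)
    also have "\<dots> = (\<Sum>j<k. snd (\<phi> u) j * L (triv_inv E U \<phi> c (std_basis j)))"
      by (intro sum.cong) auto
    finally show ?case by simp
  qed
  then show ?thesis
    using v trivialization_snd[OF triv] c by (auto simp: fibre_def)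
qed

lemma fibre_functional_coord:
  assumes "local_trivialization E U n \<phi>" "c \<in> U"
  shows "fibre_functional E c (\<lambda>v. snd (\<phi> v) i)"
  using assms by (simp add: fibre_functional_def trivialization_add trivialization_scale)

lemma fibre_functional_comp:
  assumes "fibre_linear E F c b A" "fibre_functional F b l"
  shows "fibre_functional E c (\<lambda>u. l (A u))"
  using assms by (simp add: fibre_functional_def fibre_linear_def)

text \<open>The coordinates of a chart around \<open>b\<close> are functionals, and the chart is
  injective on the fibre.\<close>

lemma fibre_functional_separates:
  assumes "vector_bundle F" "u \<in> fibre F b" "v \<in> fibre F b" "u \<noteq> v"
  obtains l where "fibre_functional F b l" "l u \<noteq> l v"
proof -
  obtain V m \<psi> where V: "b \<in> V" "local_trivialization F V m \<psi>"
    using assms(1) vector_bundle.locally_trivial by metis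
  then have "snd (\<psi> u) \<noteq> snd (\<psi> v)"
    using assms trivialization_inject by metis
  then show ?thesis
    using that fibre_functional_coord[OF V(2,1)] by (metis ext)
qed

text \<open>The description in \<open>fibre_integral\<close> determines a vector. Integrating
  \<open>h\<close> coordinatewise in a chart gives a solution, since every functional is a fixed
  linear combination of coordinates; it is the only one, since functionals separate points.\<close>

lemma functional_fibre_integral:
  assumes F: "vector_bundle F" and "\<And>l. fibre_functional F b l \<Longrightarrow> integrable M (\<lambda>c. l (h c))"
    and h: "\<And>c. c \<in> space M \<Longrightarrow> h c \<in> fibre F b"
    and "fibre_functional F b l"
  shows "l (fibre_integral F b M h) = (\<integral>c. l (h c) \<partial>M)"
proof -
  let ?P = "\<lambda>w. w \<in> fibre F b \<and> (\<forall>l. fibre_functional F b l \<longrightarrow> l w = (\<integral>c. l (h c) \<partial>M))"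
  obtain V m \<psi> where b: "b \<in> V" and V: "local_trivialization F V m \<psi>"
    using F vector_bundle.locally_trivial by metis
  define x where "x i = (\<integral>c. snd (\<psi> (h c)) i \<partial>M)" for i
  let ?w = "triv_inv F V \<psi> b x"
  \<comment> \<open>Coordinates beyond the rank integrate to 0, so \<open>x\<close> lies in the
    model fibre and really is the coordinate vector of \<open>?w\<close>.\<close>
  have "x i = 0" if "i \<ge> m" for i
  proof -
    have "x i = (\<integral>c. 0 \<partial>M)" unfolding x_def
      by (rule Bochner_Integration.integral_cong)
         (use h b that trivialization_snd[OF V] in \<open>auto simp: fibre_def\<close>)
    then show ?thesis by simp
  qed
  then have w: "\<psi> ?w = (b, x)" "?w \<in> fibre F b"
    using trivialization_triv_inv[OF V b] by blast+
  have "l ?w = (\<integral>c. l (h c) \<partial>M)" if l: "fibre_functional F b l" for l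
  proof -
    have "(\<integral>c. l (h c) \<partial>M) =
        (\<integral>c. (\<Sum>j<m. snd (\<psi> (h c)) j * l (triv_inv F V \<psi> b (std_basis j))) \<partial>M)"
      by (intro Bochner_Integration.integral_cong refl functional_expansion[OF V F l b] h)
    also have "\<dots> = (\<Sum>j<m. x j * l (triv_inv F V \<psi> b (std_basis j)))"
      using assms(2)[OF fibre_functional_coord[OF V b]]
      by (simp add: Bochner_Integration.integral_sum x_def)
    also have "\<dots> = l ?w"
      using functional_expansion[OF V F l b w(2)] w(1) by simp
    finally show ?thesis by simp
  qed
  then have "?P ?w" using w by blast
  moreover have "w' = w''" if "?P w'" "?P w''" for w' w''
    using that fibre_functional_separates[OF F, of w' b w''] by metis
  ultimately have "?P (fibre_integral F b M h)"
    unfolding fibre_integral_def by (intro theI[of ?P]) blast+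
  then show ?thesis
    using assms(4) by blast
qed


section \<open>Group actions and the kernel\<close>

lemma continuous_on_act:
  assumes "continuous_action act"
  shows "continuous_on S (act g)"
proof -
  have "continuous_on UNIV (\<lambda>(h, x). act h x)"
    using assms by (simp add: continuous_action_def)
  moreover have "continuous_on S (\<lambda>x. (g, x))"
    by (intro continuous_intros)
  ultimately have "continuous_on S (\<lambda>x. (\<lambda>(h, x). act h x) (g, x))"
    by (rule continuous_on_compose2) simp
  then show ?thesis by simp
qed

lemma act_minus:
  assumes "continuous_action act"
  shows "act (- g) (act g x) = x" "act g (act (- g) x) = x"
  using assms unfolding continuous_action_def by (metis left_minus right_minus)+

lemma act_in_orbit:
  assumes "continuous_action act" "c \<in> orbit act b"
  shows "act g c \<in> orbit act b"
proof -
  obtain h where "c = act h b"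
    using assms by (auto simp: orbit_def)
  then have "act g c = act (g + h) b"
    using assms by (simp add: continuous_action_def)
  then show ?thesis
    by (simp add: orbit_def)
qed

lemma act_minus_in_orbit:
  assumes "continuous_action act" "c \<in> orbit act (act g b)"
  shows "c \<in> orbit act b"
proof -
  obtain h where "c = act h (act g b)"
    using assms by (auto simp: orbit_def)
  then have "c = act (h + g) b"
    using assms by (simp add: continuous_action_def)
  then show ?thesis
    by (simp add: orbit_def)
qed

lemma orbit_act:
  assumes "continuous_action act"
  shows "orbit act (act g b) = orbit act b"
  using act_minus_in_orbit[OF assms] act_minus_in_orbit[OF assms, of _ "- g" "act g b"]
  by (auto simp: act_minus[OF assms])

section \<open>Continuity and support of the kernel\<close>

context orbit_kernel
begin

lemma kernel_functional:
  assumes "c \<in> orbit act b" "fibre_functional F b l"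
  shows "fibre_functional E c (\<lambda>u. l (\<kappa> (c, b) u))"
  using kernel_hom[of c b] assms
  by (intro fibre_functional_comp[of E F c b]) (auto simp: orbit_pairs_def fibre_hom_def)

lemma kernel_in_fibre:
  assumes "c \<in> orbit act b" "v \<in> fibre E c"
  shows "\<kappa> (c, b) v \<in> fibre F b"
  using kernel_hom[of c b] assms
  by (auto simp: orbit_pairs_def fibre_hom_def fibre_linear_def)

text \<open>Reading off one matrix entry is continuous, so requiring this entry to lie in an open
  \<open>T\<close> cuts out one of the generating open sets of \<open>hom_topology\<close>, whose
  preimage under the continuous kernel is open.\<close>

lemma continuous_on_kernel_matrix:
  assumes \<phi>: "local_trivialization E U n \<phi>" and \<psi>: "local_trivialization F V m \<psi>"
    and b: "b \<in> V" and ij: "i < m" "j < n"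
  shows "continuous_on (orbit act b \<inter> U)
    (\<lambda>c. snd (\<psi> (\<kappa> (c, b) (triv_inv E U \<phi> c (std_basis j)))) i)" (is "continuous_on ?S ?a")
proof -
  have "openin (top_of_set ?S) (?S \<inter> ?a -` T)" if "open T" for T
  proof -
    let ?W = "{p :: ('b \<times> 'b) \<times> (nat \<Rightarrow> nat \<Rightarrow> real). snd p i j \<in> T}"
    let ?Z = "{z \<in> hom_total E F. fst z \<in> U \<times> V \<and> hom_chart E U n \<phi> m \<psi> z \<in> ?W}"
    have "continuous_on UNIV (\<lambda>p :: ('b \<times> 'b) \<times> (nat \<Rightarrow> nat \<Rightarrow> real). snd p i j)"
      using continuous_on_product_then_coordinatewise[OF
          continuous_on_product_then_coordinatewise[OF continuous_on_snd[OF continuous_on_id]]] .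
    then have "open ?W"
      using that open_vimage[of T "\<lambda>p :: ('b \<times> 'b) \<times> (nat \<Rightarrow> nat \<Rightarrow> real). snd p i j"]
      by (simp add: vimage_def)
    then have Z: "openin (hom_topology E F) ?Z"
      unfolding hom_topology_def using \<phi> \<psi> by (intro topology_generated_by_Basis) blast
    have "continuous_map (top_of_set ?S) (top_of_set (orbit_pairs act)) (\<lambda>c. (c, b))"
      by (auto simp: continuous_map_in_subtopology orbit_pairs_def intro!: continuous_intros)
    then have "continuous_map (top_of_set ?S) (hom_topology E F) ((\<lambda>z. (z, \<kappa> z)) \<circ> (\<lambda>c. (c, b)))"
      using kernel_continuous by (rule continuous_map_compose)
    from openin_continuous_map_preimage[OF this Z]
    have "openin (top_of_set ?S) {c \<in> ?S. ((c, b), \<kappa> (c, b)) \<in> ?Z}"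
      by (simp add: o_def)
    \<comment> \<open>With \<open>b\<close> in \<open>V\<close>, \<open>i < m\<close> and
      \<open>j < n\<close>, the chart value is a genuine matrix entry and not a padding
      zero.\<close>
    moreover have "{c \<in> ?S. ((c, b), \<kappa> (c, b)) \<in> ?Z} = ?S \<inter> ?a -` T"
      using kernel_hom b ij by (auto simp: hom_chart_def hom_total_def orbit_pairs_def)
    ultimately show ?thesis by simp
  qed
  then show ?thesis
    by (simp add: continuous_openin_preimage_eq)
qed

text \<open>Turns continuity into the Hom bundle into continuity of real functions. In charts the
  pairing is a finite sum of products of coordinates of \<open>v c\<close>, matrix entries of the
  kernel and constants depending on \<open>l\<close>. The argument is local because the chart of
  \<open>E\<close> changes along \<open>S\<close>.\<close>

lemma continuous_on_kernel_functional:
  assumes E: "vector_bundle E" and F: "vector_bundle F" and S: "S \<subseteq> orbit act b"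
    and v: "continuous_on S v" "\<And>c. c \<in> S \<Longrightarrow> v c \<in> fibre E c" and l: "fibre_functional F b l"
  shows "continuous_on S (\<lambda>c. l (\<kappa> (c, b) (v c)))"
proof (rule continuous_on_locally)
  fix c0 assume c0: "c0 \<in> S"
  obtain U n \<phi> where U: "c0 \<in> U" and \<phi>: "local_trivialization E U n \<phi>"
    using E vector_bundle.locally_trivial by metis
  obtain V m \<psi> where b: "b \<in> V" and \<psi>: "local_trivialization F V m \<psi>"
    using F vector_bundle.locally_trivial by metis
  let ?e = "\<lambda>c j. triv_inv E U \<phi> c (std_basis j)"
  have "open U" using \<phi> by (simp add: local_trivialization_def)
  have eq: "l (\<kappa> (c, b) (v c)) =
      (\<Sum>j<n. snd (\<phi> (v c)) j * (\<Sum>i<m. snd (\<psi> (\<kappa> (c, b) (?e c j))) i * l (triv_inv F V \<psi> b (std_basis i))))"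
    if "c \<in> S \<inter> U" for c
  proof -
    have c: "c \<in> orbit act b" "c \<in> U" "v c \<in> fibre E c" using that S v by auto
    have "?e c j \<in> fibre E c" if "j < n" for j
      using that c by (intro trivialization_triv_inv[OF \<phi>]) auto
    then have "l (\<kappa> (c, b) (?e c j)) =
        (\<Sum>i<m. snd (\<psi> (\<kappa> (c, b) (?e c j))) i * l (triv_inv F V \<psi> b (std_basis i)))" if "j < n" for j
      using that c by (intro functional_expansion[OF \<psi> F l b] kernel_in_fibre) auto
    then show ?thesis
      by (subst functional_expansion[OF \<phi> E kernel_functional[OF c(1) l] c(2,3)]) simp
  qed
  have "continuous_on (S \<inter> U) (\<lambda>c. snd (\<phi> (v c)) j)" for j
    by (rule continuous_on_compose2[OF continuous_on_trivialization_coord[OF \<phi>]])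
       (use v continuous_on_subset[OF v(1)] in \<open>auto simp: fibre_def\<close>)
  moreover have "continuous_on (S \<inter> U) (\<lambda>c. snd (\<psi> (\<kappa> (c, b) (?e c j))) i)" if "i < m" "j < n" for i j
    using continuous_on_kernel_matrix[OF \<phi> \<psi> b that] S
    by (elim continuous_on_subset) auto
  ultimately have "continuous_on (S \<inter> U) (\<lambda>c.
      (\<Sum>j<n. snd (\<phi> (v c)) j * (\<Sum>i<m. snd (\<psi> (\<kappa> (c, b) (?e c j))) i * l (triv_inv F V \<psi> b (std_basis i)))))"
    by (intro continuous_intros) auto
  then have "continuous_on (S \<inter> U) (\<lambda>c. l (\<kappa> (c, b) (v c)))"
    by (rule continuous_on_eq) (rule eq[symmetric])
  then show "\<exists>N. openin (top_of_set S) N \<and> c0 \<in> N \<and> continuous_on N (\<lambda>c. l (\<kappa> (c, b) (v c)))"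
    using U c0 \<open>open U\<close> by (intro exI[of _ "S \<inter> U"]) (simp add: openin_open_Int)
qed

lemma kernel_compact_supportE:
  obtains K where "compact K" "K \<subseteq> orbit act b"
    "\<And>c v. c \<in> orbit act b \<Longrightarrow> c \<notin> K \<Longrightarrow> v \<in> fibre E c \<Longrightarrow> \<kappa> (c, b) v = vzero F b"
proof -
  let ?P = "{c \<in> orbit act b. \<exists>v\<in>fibre E c. \<kappa> (c, b) v \<noteq> vzero F b}"
  let ?K = "top_of_set (orbit act b) closure_of ?P"
  have "compact ?K" "?K \<subseteq> orbit act b"
    using kernel_compact_support[of b]
    by (simp_all add: compact_support_in_def compactin_subtopology)
  moreover have "?P \<subseteq> ?K"
    by (rule closure_of_subset) auto
  ultimately show ?thesis using that by blast
qed

end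

lemma fibre_functional_zero:
  assumes "vector_bundle F" "fibre_functional F b l"
  shows "l (vzero F b) = 0"
proof -
  interpret vector_bundle F by fact
  interpret real_vector_space_on "fibre F b" "vadd F" "vscale F" "vzero F b"
    by (rule fibre_vector_space)
  have "l (vadd F (vzero F b) (vzero F b)) = l (vzero F b) + l (vzero F b)"
    using assms zero_closed by (simp add: fibre_functional_def)
  then show ?thesis
    by (simp add: add_zero zero_closed)
qed


section \<open>Integration over orbits\<close>

context orbit_measures
begin

text \<open>By local finiteness, finitely many relatively open sets of finite measure cover
  \<open>K\<close>.\<close>

lemma emeasure_compact_finite:
  assumes "compact K" "K \<subseteq> orbit act b"
  shows "emeasure (\<mu> b) K < \<infinity>"
proof -
  let ?X = "orbit act b"
  have open_sets: "U \<in> sets (\<mu> b)" if "openin (top_of_set ?X) U" for U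
    using that by (auto simp: openin_open sets_orbit sets_restrict_space)
  let ?\<U> = "{U. openin (top_of_set ?X) U \<and> emeasure (\<mu> b) U < \<infinity>}"
  have "compactin (top_of_set ?X) K"
    using assms by (simp add: compactin_subtopology)
  moreover have "K \<subseteq> \<Union>?\<U>"
    using locally_finite assms by blast
  ultimately obtain \<F> where \<F>: "finite \<F>" "\<F> \<subseteq> ?\<U>" "K \<subseteq> \<Union>\<F>"
    using compactinD[of "top_of_set ?X" K ?\<U>] by auto
  have "emeasure (\<mu> b) K \<le> emeasure (\<mu> b) (\<Union>\<F>)"
    using \<F> open_sets by (intro emeasure_mono sets.finite_Union) auto
  also have "\<dots> \<le> (\<Sum>U\<in>\<F>. emeasure (\<mu> b) U)"
    using emeasure_subadditive_finite[OF \<F>(1), of "\<lambda>U. U" "\<mu> b"] \<F> open_sets by auto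
  also have "\<dots> < \<infinity>"
    using \<F> by auto
  finally show ?thesis .
qed

end

text \<open>On \<open>K\<close> the function is bounded, and \<open>K\<close> has finite measure.
  That \<open>K\<close> is Borel is assumed because the base of this locale is an arbitrary
  topological space, where compact sets need not be closed.\<close>

lemma (in orbit_measures) integrable_compact_support:
  fixes h :: "'b \<Rightarrow> real"
  assumes "continuous_on (orbit act b) h" "compact K" "K \<subseteq> orbit act b" "K \<in> sets borel"
    and zero: "\<And>c. c \<in> orbit act b \<Longrightarrow> c \<notin> K \<Longrightarrow> h c = 0"
  shows "integrable (\<mu> b) h"
proof -
  have "compact (h ` K)"
    using assms continuous_on_subset compact_continuous_image by blast
  then obtain B where B: "\<And>c. c \<in> K \<Longrightarrow> norm (h c) \<le> B"
    using compact_imp_bounded bounded_iff by (metis imageI)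
  have meas: "h \<in> borel_measurable (\<mu> b)"
    using borel_measurable_continuous_on_restrict[OF assms(1)] measurable_cong_sets[OF sets_orbit refl]
    by blast
  have "K \<in> sets (\<mu> b)"
    using assms by (auto simp: sets_orbit sets_restrict_space)
  then show ?thesis
    by (rule integrableI_bounded_set[OF _ meas emeasure_compact_finite, of _ B])
       (use assms B zero space_orbit in auto)
qed

section \<open>Pairing the transform with functionals\<close>

locale orbit_integral_transform = orbit_measures act \<mu> + orbit_kernel E F act \<kappa>
  for act :: "'g::topological_group_add \<Rightarrow> 'b::t2_space \<Rightarrow> 'b" and \<mu>
    and E :: "('e::topological_space, 'b) vbundle"
    and F :: "('f::topological_space, 'b) vbundle" and \<kappa> +
  assumes bundle_E: "vector_bundle E" and bundle_F: "vector_bundle F"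
begin

lemma integrable_kernel_functional:
  assumes "continuous_on (orbit act b) f" "\<And>c. c \<in> orbit act b \<Longrightarrow> f c \<in> fibre E c"
    and "fibre_functional F b l"
  shows "integrable (\<mu> b) (\<lambda>c. l (\<kappa> (c, b) (f c)))"
proof -
  obtain K where K: "compact K" "K \<subseteq> orbit act b"
    "\<And>c v. c \<in> orbit act b \<Longrightarrow> c \<notin> K \<Longrightarrow> v \<in> fibre E c \<Longrightarrow> \<kappa> (c, b) v = vzero F b"
    using kernel_compact_supportE by metis
  have "K \<in> sets borel"
    using K(1) by (rule borel_compact)
  with K assms show ?thesis
    by (intro integrable_compact_support[of b _ K]
        continuous_on_kernel_functional[OF bundle_E bundle_F order_refl])
       (auto simp: fibre_functional_zero[OF bundle_F])
qed

text \<open>The bridge from vector-valued to real integrals: from here on the transform is only seen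
  through functionals. Continuity and compact support of the kernel supply the
  integrability.\<close>

lemma functional_orbit_transform:
  assumes "continuous_on (orbit act b) f" "\<And>c. c \<in> orbit act b \<Longrightarrow> f c \<in> fibre E c"
    and l: "fibre_functional F b l"
  shows "l (orbit_transform F \<mu> \<kappa> f b) = (\<integral>c. l (\<kappa> (c, b) (f c)) \<partial>\<mu> b)"
proof -
  have int: "integrable (\<mu> b) (\<lambda>c. l (\<kappa> (c, b) (f c)))" if "fibre_functional F b l" for l
    using integrable_kernel_functional assms that by blast
  have fib: "\<kappa> (c, b) (f c) \<in> fibre F b" if "c \<in> space (\<mu> b)" for c
    using that assms(2) by (simp add: space_orbit kernel_in_fibre)
  show ?thesis
    unfolding orbit_transform_def
    by (rule functional_fibre_integral[OF bundle_F _ _ l]) (use int fib in blast)+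
qed

end


section \<open>Equivariance of the kernel\<close>

lemma continuous_section_act_section:
  assumes act: "continuous_action act" and E: "equivariant_vector_bundle E act actE"
    and f: "f \<in> continuous_sections E"
  shows "act_section act actE g f \<in> continuous_sections E"
proof -
  interpret equivariant_vector_bundle E act actE by fact
  have f': "\<And>b. f b \<in> fibre E b" "continuous_on UNIV f"
    using f by (auto simp: continuous_sections_def all_sections_def)
  have "act_section act actE g f b \<in> fibre E b" for b
    using f'(1)[of "act (- g) b"] act_minus(2)[OF act, of g b]
    by (simp add: fibre_def act_section_def proj_equivariant)
  moreover have "continuous_on UNIV (act_section act actE g f)"
  proof -
    have "continuous_on UNIV (\<lambda>b. f (act (- g) b))"
      by (rule continuous_on_compose2[OF f'(2) continuous_on_act[OF act]]) simp
    then have "continuous_on UNIV (\<lambda>b. actE g (f (act (- g) b)))"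
      by (rule continuous_on_compose2[OF continuous_on_act[OF action_total, of UNIV]]) simp
    then show ?thesis
      by (simp add: act_section_def[abs_def])
  qed
  ultimately show ?thesis
    by (simp add: continuous_sections_def all_sections_def)
qed

text \<open>In every chart the zero section has constant coordinates 0. It serves to extend cut-off
  sections by zero.\<close>

lemma vzero_continuous_section:
  assumes "vector_bundle E"
  shows "vzero E \<in> continuous_sections E"
proof -
  interpret vector_bundle E by fact
  have z: "vzero E b \<in> fibre E b" for b
    by (rule real_vector_space_on.zero_closed[OF fibre_vector_space])
  have "continuous_on UNIV (vzero E)"
  proof (rule continuous_on_locally)
    fix b
    obtain U n \<phi> where U: "b \<in> U" and \<phi>: "local_trivialization E U n \<phi>"
      using locally_trivial by metis
    have eq: "triv_inv E U \<phi> c (\<lambda>i. 0) = vzero E c" if "c \<in> U" for c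
    proof (rule trivialization_inject[OF \<phi> that])
      show "snd (\<phi> (triv_inv E U \<phi> c (\<lambda>i. 0))) = snd (\<phi> (vzero E c))"
        using fibre_functional_zero[OF assms fibre_functional_coord[OF \<phi> that]] that
        by (auto simp: trivialization_triv_inv[OF \<phi>] fun_eq_iff)
    qed (use that z in \<open>auto simp: trivialization_triv_inv[OF \<phi>]\<close>)
    have "continuous_on U (\<lambda>c. triv_inv E U \<phi> c (\<lambda>i. 0))"
      by (rule continuous_on_triv_inv[OF \<phi>]) (auto intro!: continuous_intros)
    then have "continuous_on U (vzero E)"
      by (rule continuous_on_eq) (rule eq)
    moreover have "open U"
      using \<phi> by (simp add: local_trivialization_def)
    ultimately show "\<exists>N. openin (top_of_set UNIV) N \<and> b \<in> N \<and> continuous_on N (vzero E)"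
      using U by auto
  qed
  with z show ?thesis
    by (simp add: continuous_sections_def all_sections_def)
qed

text \<open>Apply \<open>l\<close> to both sides of g.(T f)(b) = T(g.f)(g.b), then pull the integral
  against \<open>\<mu> (act g b)\<close> back to \<open>\<mu> b\<close> along c \<mapsto>
  g.c.\<close>

lemma (in orbit_integral_transform) equivariance_defect_integral:
  assumes act: "continuous_action act" and E: "equivariant_vector_bundle E act actE"
    and F: "equivariant_vector_bundle F act actF"
    and equivariant: "equivariant_operator E act actE actF (orbit_transform F \<mu> \<kappa>)"
    and f: "f \<in> continuous_sections E" and l: "fibre_functional F (act g b) l"
  shows "(\<integral>c. l (actF g (\<kappa> (c, b) (f c))) \<partial>\<mu> b) =
    (\<integral>c. l (\<kappa> (act g c, act g b) (actE g (f c))) \<partial>\<mu> b)"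
proof -
  interpret F: equivariant_vector_bundle F act actF by fact
  let ?T = "orbit_transform F \<mu> \<kappa>" and ?f' = "act_section act actE g f"
  let ?N = "restrict_space borel (orbit act (act g b))"
  have f': "?f' \<in> continuous_sections E"
    using continuous_section_act_section[OF act E f] .
  have sec: "continuous_on S s" "s c \<in> fibre E c" if "s \<in> continuous_sections E" for s S c
    using that continuous_on_subset by (auto simp: continuous_sections_def all_sections_def)
  \<comment> \<open>Composing \<open>l\<close> with the action of \<open>g\<close> gives a
    functional over \<open>b\<close>, so the left-hand integral is also a transform value tested by
    a functional.\<close>
  have lg: "fibre_functional F b (\<lambda>u. l (actF g u))"
    by (rule fibre_functional_comp[OF F.action_linear l])
  have "(\<integral>c. l (actF g (\<kappa> (c, b) (f c))) \<partial>\<mu> b) = l (actF g (?T f b))"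
    using functional_orbit_transform[OF sec[OF f] lg] by simp
  also have "actF g (?T f b) = act_section act actF g (?T f) (act g b)"
    by (simp add: act_section_def act_minus[OF act])
  also have "\<dots> = ?T ?f' (act g b)"
    using equivariant f by (simp add: equivariant_operator_def)
  also have "l (?T ?f' (act g b)) = (\<integral>c. l (\<kappa> (c, act g b) (?f' c)) \<partial>\<mu> (act g b))"
    by (rule functional_orbit_transform[OF sec[OF f'] l])
  also have "\<dots> = (\<integral>c. l (\<kappa> (act g c, act g b) (?f' (act g c))) \<partial>\<mu> b)"
    unfolding pushforward
  proof (rule integral_distr)
    have "act g \<in> measurable (restrict_space borel (orbit act b)) ?N"
      using borel_measurable_continuous_on_restrict[OF continuous_on_act[OF act]]
      by (auto simp: space_restrict_space orbit_act[OF act] intro: act_in_orbit[OF act]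
          intro!: measurable_restrict_space2)
    then show "act g \<in> measurable (\<mu> b) ?N"
      using measurable_cong_sets[OF sets_orbit refl] by blast
    show "(\<lambda>c. l (\<kappa> (c, act g b) (?f' c))) \<in> borel_measurable ?N"
      by (intro borel_measurable_continuous_on_restrict continuous_on_kernel_functional
          bundle_E bundle_F order_refl sec[OF f'] l)
  qed
  \<comment> \<open>By definition (g.f)(g.c) = g.f(c).\<close>
  also have "\<dots> = (\<integral>c. l (\<kappa> (act g c, act g b) (actE g (f c))) \<partial>\<mu> b)"
    by (simp add: act_section_def act_minus[OF act])
  finally show ?thesis .
qed

text \<open>The section is continuous on \<open>W\<close> by charts and on \<open>X - C\<close>,
  where it is the zero section; these two relatively open sets cover \<open>X\<close>.\<close>

lemma local_section_cutoff:
  fixes X :: "'b::t2_space set"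
  assumes E: "vector_bundle E" and WX: "openin (top_of_set X) W"
    and v: "continuous_on W v" "\<And>c. c \<in> W \<Longrightarrow> v c \<in> fibre E c"
    and a: "continuous_on W a" and C: "compact C" "C \<subseteq> W" "\<And>c. c \<notin> C \<Longrightarrow> a c = 0"
  shows "compactly_supported_section_on E X (\<lambda>c. if c \<in> W then vscale E (a c) (v c) else vzero E c)"
    (is "compactly_supported_section_on E X ?s")
proof -
  interpret vector_bundle E by fact
  have WX': "W \<subseteq> X" using WX openin_imp_subset by blast
  have z: "continuous_on UNIV (vzero E)"
    using vzero_continuous_section[OF E] by (simp add: continuous_sections_def)
  have fib: "?s c \<in> fibre E c" for c
    using real_vector_space_on.scale_closed[OF fibre_vector_space]
      real_vector_space_on.zero_closed[OF fibre_vector_space] v by auto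
  have zero: "?s c = vzero E c" if "c \<notin> C" for c
  proof (cases "c \<in> W")
    case True
    interpret real_vector_space_on "fibre E c" "vadd E" "vscale E" "vzero E c"
      by (rule fibre_vector_space)
    obtain U n \<phi> where U: "c \<in> U" and \<phi>: "local_trivialization E U n \<phi>"
      using locally_trivial by metis
    \<comment> \<open>That 0 times a vector is zero is not an axiom of
      \<open>real_vector_space_on\<close>; here it is read off from chart coordinates.\<close>
    have "vscale E 0 (v c) = vzero E c"
      by (rule trivialization_inject[OF \<phi> U])
         (use True v U fibre_functional_zero[OF E fibre_functional_coord[OF \<phi> U]]
          in \<open>auto simp: scale_closed zero_closed trivialization_scale[OF \<phi>]\<close>)
    then show ?thesis using C(3)[OF that] by simp
  qed simp
  have "continuous_on W ?s"
  proof (rule continuous_on_locally)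
    fix c assume c: "c \<in> W"
    obtain U n \<phi> where U: "c \<in> U" and \<phi>: "local_trivialization E U n \<phi>"
      using locally_trivial by metis
    have "open U"
      using \<phi> by (simp add: local_trivialization_def)
    have "continuous_on (W \<inter> U) v" "continuous_on (W \<inter> U) a"
      using v a continuous_on_subset by blast+
    then have "continuous_on (W \<inter> U) (\<lambda>c. snd (\<phi> (v c)) i)" for i
      by (intro continuous_on_compose2[OF continuous_on_trivialization_coord[OF \<phi>]])
         (use v in \<open>auto simp: fibre_def\<close>)
    \<comment> \<open>Continuity of fibrewise scaling comes from multiplying the coordinates and
      applying the continuous inverse chart.\<close>
    then have "continuous_on (W \<inter> U) (\<lambda>c. triv_inv E U \<phi> c (\<lambda>i. a c * snd (\<phi> (v c)) i))"
      by (intro continuous_on_triv_inv[OF \<phi>] continuous_intros \<open>continuous_on (W \<inter> U) a\<close>)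
         (use v trivialization_snd[OF \<phi>] in \<open>auto simp: fibre_def\<close>)
    moreover have "triv_inv E U \<phi> x (\<lambda>i. a x * snd (\<phi> (v x)) i) = ?s x" if "x \<in> W \<inter> U" for x
      using triv_inv_trivialization[OF \<phi>, of x "?s x"] fib[of x] that
        trivialization_scale[OF \<phi>, of x "v x" "a x"] v(2)[of x] by simp
    ultimately have "continuous_on (W \<inter> U) ?s"
      by (subst continuous_on_cong[OF refl, symmetric])
    then show "\<exists>N. openin (top_of_set W) N \<and> c \<in> N \<and> continuous_on N ?s"
      using U c \<open>open U\<close> by (intro exI[of _ "W \<inter> U"]) (simp add: openin_open_Int)
  qed
  moreover have "continuous_on (X - C) ?s"
    by (rule continuous_on_eq[OF continuous_on_subset[OF z subset_UNIV]]) (metis DiffD2 zero)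
  moreover have "openin (top_of_set X) (X - C)"
    using compact_imp_closed[OF C(1)] by (metis Diff_eq openin_open open_Compl)
  ultimately have "continuous_on X ?s"
    using WX C(2) by (intro continuous_on_locally[of X ?s]) (metis Diff_iff subsetD)
  moreover have "compact_support_in X (\<lambda>c. ?s c \<noteq> vzero E c)"
  proof -
    have "closedin (top_of_set X) C"
      using C WX' compact_imp_closed by (intro closed_subset) auto
    \<comment> \<open>Being compact in a Hausdorff space, \<open>C\<close> is closed, so it contains
      the closure of the support, which is then compact too.\<close>
    then have "top_of_set X closure_of {c \<in> X. ?s c \<noteq> vzero E c} \<subseteq> C"
      using zero by (intro closure_of_minimal) blast+
    moreover have "compactin (top_of_set X) C"
      using C WX' by (auto simp: compactin_subtopology)
    ultimately show ?thesis
      unfolding compact_support_in_def using closed_compactin closedin_closure_of by blast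
  qed
  ultimately show ?thesis
    using fib unfolding compactly_supported_section_on_def by blast
qed

section \<open>Testing the equivariance defect on a single orbit\<close>

lemma (in orbit_integral_transform) kernel_equivariant:
  assumes act: "continuous_action act" and E: "equivariant_vector_bundle E act actE"
    and F: "equivariant_vector_bundle F act actF"
    and equivariant: "equivariant_operator E act actE actF (orbit_transform F \<mu> \<kappa>)"
    and positive: "strictly_positive_on (orbit act b) (\<mu> b)"
    and extend: "\<And>s. compactly_supported_section_on E (orbit act b) s \<Longrightarrow>
      \<exists>f\<in>continuous_sections E. \<forall>c\<in>orbit act b. f c = s c"
    and c0: "c0 \<in> orbit act b" and v0: "v0 \<in> fibre E c0"
  shows "actF g (\<kappa> (c0, b) v0) = \<kappa> (act g c0, act g b) (actE g v0)"
proof (rule ccontr)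
  assume ne: "actF g (\<kappa> (c0, b) v0) \<noteq> \<kappa> (act g c0, act g b) (actE g v0)"
  interpret E: equivariant_vector_bundle E act actE by fact
  interpret F: equivariant_vector_bundle F act actF by fact
  let ?X = "orbit act b"
  have actX: "act h c \<in> orbit act (act g b) \<longleftrightarrow> c \<in> ?X" for h c
    using act_in_orbit[OF act] act_minus_in_orbit[OF act] orbit_act[OF act] act_minus[OF act] by metis
  have actE_fibre: "actE g v \<in> fibre E (act g c)" if "v \<in> fibre E c" for v c
    using that E.proj_equivariant by (simp add: fibre_def)
  have "actF g (\<kappa> (c0, b) v0) \<in> fibre F (act g b)"
    using kernel_in_fibre[OF c0 v0] F.proj_equivariant by (simp add: fibre_def)
  moreover have "\<kappa> (act g c0, act g b) (actE g v0) \<in> fibre F (act g b)"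
    using kernel_in_fibre[of "act g c0" "act g b"] actE_fibre[OF v0] actX c0 by blast
  ultimately obtain l where l: "fibre_functional F (act g b) l"
    and l_ne: "l (actF g (\<kappa> (c0, b) v0)) \<noteq> l (\<kappa> (act g c0, act g b) (actE g v0))"
    using fibre_functional_separates[OF bundle_F _ _ ne] by metis
  have lg: "fibre_functional F b (\<lambda>u. l (actF g u))"
    by (rule fibre_functional_comp[OF F.action_linear l])
  \<comment> \<open>The equivariance defect at \<open>c\<close>, made scalar by \<open>l\<close>;
    both terms come from vectors in the fibre over \<open>act g b\<close>.\<close>
  define D where "D c u = l (actF g (\<kappa> (c, b) u)) - l (\<kappa> (act g c, act g b) (actE g u))" for c u
  have continuous_D: "continuous_on S (\<lambda>c. D c (s c))"
    if "S \<subseteq> ?X" "continuous_on S s" "\<And>c. c \<in> S \<Longrightarrow> s c \<in> fibre E c" for S s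
  proof -
    \<comment> \<open>For the second term, \<open>s\<close> is moved to the section c \<mapsto>
      g.s(-g.c) over the translated set, where continuity of the kernel at \<open>act g b\<close>
      applies, and the result is pulled back along \<open>act g\<close>.\<close>
    have "continuous_on (act g ` S) (\<lambda>c. s (act (- g) c))"
      by (rule continuous_on_compose2[OF that(2) continuous_on_act[OF act]])
         (auto simp: act_minus[OF act])
    then have "continuous_on (act g ` S) (\<lambda>c. actE g (s (act (- g) c)))"
      by (rule continuous_on_compose2[OF continuous_on_act[OF E.action_total, of UNIV]]) simp
    then have "continuous_on (act g ` S) (\<lambda>c. l (\<kappa> (c, act g b) (actE g (s (act (- g) c)))))"
      by (rule continuous_on_kernel_functional[OF bundle_E bundle_F _ _ _ l, rotated])
         (use that actE_fibre in \<open>auto simp: act_minus[OF act] actX subset_iff\<close>)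
    then have "continuous_on S (\<lambda>c. l (\<kappa> (act g c, act g b) (actE g (s (act (- g) (act g c))))))"
      by (rule continuous_on_compose2[OF _ continuous_on_act[OF act]]) simp
    moreover have "continuous_on S (\<lambda>c. l (actF g (\<kappa> (c, b) (s c))))"
      by (rule continuous_on_kernel_functional[OF bundle_E bundle_F that lg])
    ultimately show ?thesis
      unfolding D_def by (simp add: act_minus[OF act] continuous_on_diff)
  qed
  obtain K where K: "compact K" "K \<subseteq> ?X"
    and K0: "\<And>c u. c \<in> ?X \<Longrightarrow> c \<notin> K \<Longrightarrow> u \<in> fibre E c \<Longrightarrow> D c u = 0"
  proof -
    obtain K1 where K1: "compact K1" "K1 \<subseteq> ?X"
      "\<And>c v. c \<in> ?X \<Longrightarrow> c \<notin> K1 \<Longrightarrow> v \<in> fibre E c \<Longrightarrow> \<kappa> (c, b) v = vzero F b"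
      using kernel_compact_supportE[of b] by metis
    obtain K2 where K2: "compact K2" "K2 \<subseteq> orbit act (act g b)"
      "\<And>c v. c \<in> orbit act (act g b) \<Longrightarrow> c \<notin> K2 \<Longrightarrow> v \<in> fibre E c \<Longrightarrow>
        \<kappa> (c, act g b) v = vzero F (act g b)"
      using kernel_compact_supportE[of "act g b"] by metis
    \<comment> \<open>The support of the kernel at \<open>act g b\<close> has to be translated back
      by \<open>- g\<close> to bound the support of the second term.\<close>
    let ?K = "K1 \<union> act (- g) ` K2"
    have "compact ?K"
      using K1 K2 compact_continuous_image[OF continuous_on_act[OF act]] by blast
    moreover have "?K \<subseteq> ?X"
      using K1 K2 act_in_orbit[OF act] orbit_act[OF act] by blast
    moreover have "D c u = 0" if c: "c \<in> ?X" "c \<notin> ?K" and u: "u \<in> fibre E c" for c u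
    proof -
      have "act g c \<notin> K2"
        using c act_minus(1)[OF act, of g c] by (metis UnI2 imageI)
      then have "\<kappa> (act g c, act g b) (actE g u) = vzero F (act g b)"
        using K2(3) c actX actE_fibre[OF u] by blast
      moreover have "\<kappa> (c, b) u = vzero F b"
        using K1(3) c u by blast
      ultimately show ?thesis
        using fibre_functional_zero[OF bundle_F l] fibre_functional_zero[OF bundle_F lg]
        by (simp add: D_def)
    qed
    ultimately show ?thesis using that by blast
  qed
  obtain U n \<phi> where U: "c0 \<in> U" and \<phi>: "local_trivialization E U n \<phi>"
    using E.locally_trivial by metis
  have "open U"
    using \<phi> by (simp add: local_trivialization_def)
  \<comment> \<open>The local section through \<open>v0\<close> with constant coordinates in the
    chart.\<close>
  define v where "v c = triv_inv E U \<phi> c (snd (\<phi> v0))" for c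
  have v0_coord: "snd (\<phi> v0) i = 0" if "i \<ge> n" for i
    using trivialization_snd[OF \<phi>, of v0 i] that U v0 by (simp add: fibre_def)
  have v_fibre: "v c \<in> fibre E c" if "c \<in> U" for c
    using trivialization_triv_inv[OF \<phi> that] v0_coord by (simp add: v_def)
  have v_c0: "v c0 = v0"
    using triv_inv_trivialization[OF \<phi> U v0] by (simp add: v_def)
  have continuous_v: "continuous_on U v"
    unfolding v_def
    by (rule continuous_on_triv_inv[OF \<phi>]) (use v0_coord in \<open>auto intro: continuous_on_const continuous_on_id\<close>)
  define d where "d c = D c (v c)" for c
  have continuous_d: "continuous_on (?X \<inter> U) d"
    unfolding d_def
    by (rule continuous_D) (use v_fibre continuous_on_subset[OF continuous_v] in auto)
  define W where "W = (?X \<inter> U) \<inter> d -` (- {0})"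
  have "openin (top_of_set (?X \<inter> U)) W"
    unfolding W_def using continuous_openin_preimage_gen[OF continuous_d] by blast
  moreover have "openin (top_of_set ?X) (?X \<inter> U)"
    using \<open>open U\<close> by (rule openin_open_Int)
  ultimately have W: "openin (top_of_set ?X) W"
    by (rule openin_trans)
  \<comment> \<open>This is what confines an open neighbourhood of \<open>c0\<close> to a compact
    set, as the bump function requires.\<close>
  have "W \<subseteq> K"
    using K0 v_fibre by (auto simp: W_def d_def)
  have c0W: "c0 \<in> W"
    using c0 U l_ne by (simp add: W_def d_def D_def v_c0)
  obtain \<eta> :: "'b \<Rightarrow> real" and C where \<eta>: "continuous_on ?X \<eta>" "\<eta> c0 = 1" "\<And>c. \<eta> c \<ge> 0"
    and C: "compact C" "C \<subseteq> W" "\<And>c. c \<notin> C \<Longrightarrow> \<eta> c = 0"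
    by (rule compact_support_bump[OF K(1) \<open>W \<subseteq> K\<close> K(2) W c0W]) (rule that)
  \<comment> \<open>The additional factor \<open>d\<close> turns the pairing with \<open>D\<close> into \<open>\<eta> d\<^sup>2 \<ge> 0\<close>.\<close>
  define s where "s c = (if c \<in> W then vscale E (\<eta> c * d c) (v c) else vzero E c)" for c
  have WU: "W \<subseteq> ?X \<inter> U" by (auto simp: W_def)
  have "compactly_supported_section_on E ?X s"
    unfolding s_def
  proof (rule local_section_cutoff[OF bundle_E W _ _ _ C(1,2)])
    show "continuous_on W v"
      using continuous_v WU continuous_on_subset by (metis le_inf_iff)
    show "continuous_on W (\<lambda>c. \<eta> c * d c)"
      using WU continuous_on_subset[OF \<eta>(1), of W] continuous_on_subset[OF continuous_d, of W]
      by (intro continuous_on_mult) auto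
  qed (use WU v_fibre C(3) in auto)
  then obtain f where f: "f \<in> continuous_sections E" and fs: "\<And>c. c \<in> ?X \<Longrightarrow> f c = s c"
    using extend by blast
  have f_sec: "continuous_on S f" "f c \<in> fibre E c" for S c
    using f continuous_on_subset by (auto simp: continuous_sections_def all_sections_def)
  let ?h = "\<lambda>c. D c (f c)"
  have h_W: "?h c = \<eta> c * (d c)\<^sup>2" if "c \<in> W" for c
  proof -
    have c: "c \<in> ?X" "v c \<in> fibre E c" using that WU v_fibre by auto
    have scale: "actE g (vscale E r (v c)) = vscale E r (actE g (v c))" for r
      using E.action_linear c by (simp add: fibre_linear_def)
    have "fibre_functional E (act g c) (\<lambda>u. l (\<kappa> (act g c, act g b) u))"
      using kernel_functional l c actX by blast
    \<comment> \<open>Since \<open>D c\<close> is linear, the factor \<eta> d of the test section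
      comes out and meets \<open>D c (v c) = d c\<close>.\<close>
    then have "D c (vscale E r (v c)) = r * D c (v c)" for r
      using kernel_functional[OF c(1) lg] c actE_fibre[OF c(2)]
      by (simp add: D_def scale fibre_functional_def right_diff_distrib)
    then show ?thesis
      using that fs[OF c(1)] by (simp add: s_def d_def power2_eq_square)
  qed
  have h_nonneg: "?h c \<ge> 0" if "c \<in> ?X" for c
  proof (cases "c \<in> W")
    case True
    then show ?thesis using h_W \<eta>(3) by simp
  next
    case False
    \<comment> \<open>Off \<open>W\<close> the test section is zero, and both terms of the defect
      vanish on the zero vector by linearity.\<close>
    have "fibre_functional E (act g c) (\<lambda>u. l (\<kappa> (act g c, act g b) u))"
      using kernel_functional l that actX by blast
    then have "fibre_functional E c (\<lambda>u. l (\<kappa> (act g c, act g b) (actE g u)))"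
      by (rule fibre_functional_comp[OF E.action_linear])
    from fibre_functional_zero[OF bundle_E this]
    show ?thesis
      using fibre_functional_zero[OF bundle_E kernel_functional[OF that lg]] False fs[OF that]
      by (simp add: D_def s_def)
  qed
  have continuous_h: "continuous_on ?X ?h"
    by (rule continuous_D) (use f_sec in auto)
  have Kborel: "K \<in> sets borel"
    using K(1) by (rule borel_compact)
  have int1: "integrable (\<mu> b) (\<lambda>c. l (actF g (\<kappa> (c, b) (f c))))"
    by (rule integrable_kernel_functional[OF f_sec lg])
  have int_h: "integrable (\<mu> b) ?h"
    by (rule integrable_compact_support[OF continuous_h K]) (use K0 f_sec Kborel in auto)
  \<comment> \<open>Subtracting the integrable defect from the integrable first term yields
    integrability of the second, so the integral of the difference may be split.\<close>
  have "integrable (\<mu> b) (\<lambda>c. l (actF g (\<kappa> (c, b) (f c))) - ?h c)"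
    using int1 int_h by (rule Bochner_Integration.integrable_diff)
  then have int2: "integrable (\<mu> b) (\<lambda>c. l (\<kappa> (act g c, act g b) (actE g (f c))))"
    by (simp add: D_def)
  have "(\<integral>c. ?h c \<partial>\<mu> b) = 0"
    unfolding D_def
    using equivariance_defect_integral[OF act E F equivariant f l]
    by (simp add: Bochner_Integration.integral_diff[OF int1 int2])
  moreover have "AE c in \<mu> b. 0 \<le> ?h c"
    using h_nonneg by (intro AE_I2) (simp add: space_orbit)
  ultimately have AE: "AE c in \<mu> b. ?h c = 0"
    using integral_nonneg_eq_0_iff_AE[OF int_h] by blast
  \<comment> \<open>The nonnegative integrand vanishes almost everywhere, so this open set is null.
    It contains \<open>c0\<close>, where the integrand equals the square of \<open>d c0\<close>,
    which is non-zero; strict positivity forbids this.\<close>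
  let ?O = "?X \<inter> ?h -` (- {0})"
  have O: "openin (top_of_set ?X) ?O"
    using continuous_openin_preimage_gen[OF continuous_h] by blast
  then have O_sets: "?O \<in> sets (\<mu> b)"
    unfolding openin_open by (auto simp: sets_orbit sets_restrict_space)
  have "emeasure (\<mu> b) ?O = 0"
    using AE_iff_measurable[OF O_sets, of "\<lambda>c. ?h c = 0"] AE by (auto simp: space_orbit)
  moreover have "c0 \<in> ?O"
    using h_W[OF c0W] c0W c0 \<eta>(2) by (simp add: W_def)
  ultimately show False
    using positive O unfolding strictly_positive_on_def by (metis empty_iff less_irrefl)
qed

theorem proposition3p2:
  fixes act :: "'g::{topological_group_add, t2_space} \<Rightarrow> 'b::t2_space \<Rightarrow> 'b"
    and E :: "('e::topological_space, 'b) vbundle"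
    and F :: "('f::topological_space, 'b) vbundle"
    and actE :: "'g \<Rightarrow> 'e \<Rightarrow> 'e"
    and actF :: "'g \<Rightarrow> 'f \<Rightarrow> 'f"
    and \<mu> :: "'b \<Rightarrow> 'b measure"
    and \<kappa> :: "'b \<times> 'b \<Rightarrow> 'e \<Rightarrow> 'f"
  assumes "continuous_action act"
    and "equivariant_vector_bundle E act actE"
    and "equivariant_vector_bundle F act actF"
    and "orbit_measures act \<mu>"
    and "orbit_kernel E F act \<kappa>"
    and "equivariant_operator E act actE actF (orbit_transform F \<mu> \<kappa>)"
    and "\<And>b. strictly_positive_on (orbit act b) (\<mu> b)"
    and "\<And>b. paracompact_space (top_of_set (orbit act b))"
    and "\<And>b s. compactly_supported_section_on E (orbit act b) s \<Longrightarrow>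
           \<exists>f\<in>continuous_sections E. \<forall>c\<in>orbit act b. f c = s c"
  shows "\<forall>g b. \<forall>c\<in>orbit act b. \<forall>v\<in>fibre E c.
           actF g (\<kappa> (c, b) v) = \<kappa> (act g c, act g b) (actE g v)"
proof -
  interpret orbit_integral_transform act \<mu> E F \<kappa>
    using assms(2-5)
    by (simp add: orbit_integral_transform_def orbit_integral_transform_axioms_def
        equivariant_vector_bundle_def)
  show ?thesis
    using kernel_equivariant[OF assms(1-3,6,7,9)] by blast
qed

end
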